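(* Let $G$ be a compactly generated locally compact group. Assume that $\varphi:G\to G$ is a continuous, surjective and non-injective endomorphism of $G$ such that $K_\varphi=\bigcup_{n\ge 1}\ker(\varphi^n)$ is a closed subgroup of $G$. Then the group $G_\varphi=G/K_\varphi$ is densely related.
   Context: For a group $G$ with a generating subset $S$, let $F_S$ be the free group on $S$ with its word length, let $N$ be the kernel of the natural map $F_S\to G$, and for $n\ge 0$ let $N_n$ be the normal subgroup of $F_S$ generated (as a normal subgroup) by the elements of $N$ of length at most $n$ ($N_{-1}$ is trivial). The relation range $\mathcal{R}_S(G)$ is the set of integers $n\ge 0$ such that $N_n$ properly contains $N_{n-1}$. A compactly generated locally compact group $G$ is densely related if, for a compact generating subset $S$, there exists $c>0$ such that for all integers $n\ge 1$ we have $\mathcal{R}_S(G)\cap[n,cn]\neq\emptyset$ (this does not depend on the choice of compact generating subset $S$). Note that $K_\varphi$ is an increasing union of normal subgroups of $G$, hence a normal subgroup; when it is closed, $G/K_\varphi$ is a compactly generated locally compact group. *)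

theory Defs
  imports "HOL-Analysis.Analysis" "HOL-Algebra.Generated_Groups"
begin

section \<open>Free groups\<close>

text \<open>
  The free group on \<open>S\<close> is realised on the reduced words over \<open>S\<close> and its formal inverses: the letter
  \<open>(s, True)\<close> stands for the generator \<open>s\<close>, and \<open>(s, False)\<close> for its inverse in the free group. The
  word length of an element is then the length of the list.
\<close>

type_synonym 'a letter = "'a \<times> bool"

definition inv_letter :: "'a letter \<Rightarrow> 'a letter"
  where "inv_letter p = (fst p, \<not> snd p)"

definition reduced :: "'a letter list \<Rightarrow> bool"
  where "reduced w \<longleftrightarrow> successively (\<lambda>p q. q \<noteq> inv_letter p) w"

fun cons_red :: "'a letter \<Rightarrow> 'a letter list \<Rightarrow> 'a letter list" where
  "cons_red p [] = [p]"
| "cons_red p (q # w) = (if q = inv_letter p then w else p # q # w)"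

definition free_group :: "'a set \<Rightarrow> 'a letter list monoid" where
  "free_group S =
     \<lparr> carrier = {w. fst ` set w \<subseteq> S \<and> reduced w},
       mult = (\<lambda>u v. foldr cons_red u v),
       one = [] \<rparr>"

definition letter_val :: "('a, 'b) monoid_scheme \<Rightarrow> 'a letter \<Rightarrow> 'a"
  where "letter_val G p = (if snd p then fst p else inv\<^bsub>G\<^esub> (fst p))"

text \<open>The natural map from the free group on \<open>S\<close> to \<open>G\<close>, for \<open>S \<subseteq> carrier G\<close>.\<close>

definition word_val :: "('a, 'b) monoid_scheme \<Rightarrow> 'a letter list \<Rightarrow> 'a"
  where "word_val G w = foldr (\<lambda>p x. letter_val G p \<otimes>\<^bsub>G\<^esub> x) w \<one>\<^bsub>G\<^esub>"

lemma inv_letter_inv_letter [simp]: "inv_letter (inv_letter p) = p"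
  by (simp add: inv_letter_def)

lemma fst_inv_letter [simp]: "fst (inv_letter p) = fst p"
  by (simp add: inv_letter_def)

lemma reduced_Nil [simp]: "reduced []"
  by (simp add: reduced_def)

lemma reduced_Cons: "reduced (p # w) \<longleftrightarrow> reduced w \<and> (w = [] \<or> hd w \<noteq> inv_letter p)"
  by (auto simp: reduced_def successively_Cons)

lemma reduced_cons_red: "reduced w \<Longrightarrow> reduced (cons_red p w)"
  by (cases w) (auto simp: reduced_Cons)

lemma cons_red_inv: "reduced w \<Longrightarrow> cons_red (inv_letter p) (cons_red p w) = w"
proof (cases w)
  case (Cons q u)
  assume "reduced w"
  then show ?thesis
    using Cons by (cases u) (auto simp: reduced_Cons)
qed simp

lemma cons_red_inv': "reduced w \<Longrightarrow> cons_red p (cons_red (inv_letter p) w) = w"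
  using cons_red_inv[of w "inv_letter p"] by simp

lemma set_cons_red: "set (cons_red p w) \<subseteq> insert p (set w)"
  by (cases w) auto

lemma reduced_foldr: "reduced w \<Longrightarrow> reduced (foldr cons_red u w)"
  by (induction u) (auto intro: reduced_cons_red)

lemma set_foldr: "set (foldr cons_red u w) \<subseteq> set u \<union> set w"
proof (induction u)
  case (Cons p u)
  then show ?case using set_cons_red[of p "foldr cons_red u w"] by auto
qed simp

lemma foldr_reduced: "reduced u \<Longrightarrow> foldr cons_red u [] = u"
proof (induction u)
  case (Cons p u)
  then show ?case by (cases u) (auto simp: reduced_Cons)
qed simp

lemma foldr_cons_red:
  assumes "reduced w"
  shows "foldr cons_red (cons_red p u) w = cons_red p (foldr cons_red u w)"
proof (cases u)
  case (Cons q v)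
  then show ?thesis
    using cons_red_inv'[OF reduced_foldr[OF assms]] by auto
qed simp

lemma foldr_assoc:
  assumes "reduced w"
  shows "foldr cons_red (foldr cons_red u v) w = foldr cons_red u (foldr cons_red v w)"
  by (induction u) (simp_all add: foldr_cons_red assms)

lemma foldr_inverse:
  assumes "reduced w"
  shows "foldr cons_red (rev (map inv_letter u)) (foldr cons_red u w) = w"
  by (induction u) (simp_all add: cons_red_inv reduced_foldr assms)

lemma group_free_group: "group (free_group S)"
proof (rule groupI)
  fix x y assume "x \<in> carrier (free_group S)" "y \<in> carrier (free_group S)"
  then show "x \<otimes>\<^bsub>free_group S\<^esub> y \<in> carrier (free_group S)"
    using set_foldr[of x y] by (fastforce simp: free_group_def reduced_foldr)
next
  fix x assume x: "x \<in> carrier (free_group S)"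
  define y where "y = foldr cons_red (rev (map inv_letter x)) []"
  have "fst ` set y \<subseteq> fst ` (set (rev (map inv_letter x)) \<union> set [])"
    unfolding y_def by (intro image_mono set_foldr)
  also have "\<dots> = fst ` set x"
    by (simp add: image_image)
  finally have "y \<in> carrier (free_group S)"
    using x by (auto simp: free_group_def y_def reduced_foldr)
  moreover have "y \<otimes>\<^bsub>free_group S\<^esub> x = \<one>\<^bsub>free_group S\<^esub>"
    using x foldr_inverse[of "[]" x]
    by (simp add: free_group_def y_def foldr_assoc foldr_reduced)
  ultimately show "\<exists>y\<in>carrier (free_group S). y \<otimes>\<^bsub>free_group S\<^esub> x = \<one>\<^bsub>free_group S\<^esub>"
    by blast
qed (auto simp: free_group_def foldr_assoc)

context group
begin

lemma letter_val_closed: "fst p \<in> carrier G \<Longrightarrow> letter_val G p \<in> carrier G"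
  by (simp add: letter_val_def)

lemma letter_val_inv_letter:
  "fst p \<in> carrier G \<Longrightarrow> letter_val G p \<otimes> letter_val G (inv_letter p) = \<one>"
  by (simp add: letter_val_def inv_letter_def)

lemma word_val_Nil [simp]: "word_val G [] = \<one>"
  by (simp add: word_val_def)

lemma word_val_Cons [simp]: "word_val G (p # w) = letter_val G p \<otimes> word_val G w"
  by (simp add: word_val_def)

lemma word_val_closed: "fst ` set w \<subseteq> carrier G \<Longrightarrow> word_val G w \<in> carrier G"
  by (induction w) (auto intro!: m_closed letter_val_closed)

lemma word_val_cons_red:
  assumes "fst p \<in> carrier G" "fst ` set w \<subseteq> carrier G"
  shows "word_val G (cons_red p w) = letter_val G p \<otimes> word_val G w"
proof (cases w)
  case (Cons q u)
  show ?thesis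
  proof (cases "q = inv_letter p")
    case True
    have "letter_val G p \<otimes> (letter_val G q \<otimes> word_val G u) = word_val G u"
      using assms Cons True
      by (simp add: m_assoc[symmetric] letter_val_closed word_val_closed letter_val_inv_letter)
    then show ?thesis using Cons True by simp
  qed (use Cons in auto)
qed simp

lemma word_val_foldr:
  assumes "fst ` set u \<subseteq> carrier G" "fst ` set v \<subseteq> carrier G"
  shows "word_val G (foldr cons_red u v) = word_val G u \<otimes> word_val G v"
  using assms(1)
proof (induction u)
  case (Cons p u)
  have "fst ` set (foldr cons_red u v) \<subseteq> carrier G"
    using set_foldr[of u v] Cons.prems assms(2) by fastforce
  then show ?case
    using Cons assms(2) by (simp add: word_val_cons_red m_assoc letter_val_closed word_val_closed)
qed (simp add: assms(2) word_val_closed)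

lemma word_val_hom:
  assumes "S \<subseteq> carrier G"
  shows "word_val G \<in> hom (free_group S) G"
  using assms by (intro homI) (auto simp: free_group_def intro!: word_val_closed word_val_foldr)

lemma word_val_generator: "s \<in> carrier G \<Longrightarrow> word_val G [(s, True)] = s"
  by (simp add: letter_val_def)

end


section \<open>Relation range\<close>

definition normal_closure :: "('a, 'b) monoid_scheme \<Rightarrow> 'a set \<Rightarrow> 'a set"
  where "normal_closure G A = \<Inter>{H. H \<lhd> G \<and> A \<subseteq> H}"

definition relators :: "('a, 'b) monoid_scheme \<Rightarrow> 'a set \<Rightarrow> 'a letter list set"
  where "relators G S = kernel (free_group S) G (word_val G)"

text \<open>The index is an integer because index \<open>-1\<close> is needed; there it yields the trivial subgroup.\<close>

definition relators_le :: "('a, 'b) monoid_scheme \<Rightarrow> 'a set \<Rightarrow> int \<Rightarrow> 'a letter list set"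
  where "relators_le G S n = normal_closure (free_group S) {w \<in> relators G S. int (length w) \<le> n}"

lemma relators_le_minus_one: "relators_le G S (-1) = {\<one>\<^bsub>free_group S\<^esub>}"
proof -
  interpret F: group "free_group S" by (rule group_free_group)
  have "{w \<in> relators G S. int (length w) \<le> -1} = {}"
    by auto
  moreover have "{\<one>\<^bsub>free_group S\<^esub>} \<lhd> free_group S"
    by (rule F.one_is_normal)
  moreover have "\<one>\<^bsub>free_group S\<^esub> \<in> H" if "H \<lhd> free_group S" for H
    using that by (simp add: normal_def subgroup.one_closed)
  ultimately show ?thesis
    unfolding relators_le_def normal_closure_def by auto
qed

definition relation_range :: "('a, 'b) monoid_scheme \<Rightarrow> 'a set \<Rightarrow> int set"
  where "relation_range G S = {n. 0 \<le> n \<and> relators_le G S (n - 1) \<subset> relators_le G S n}"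


section \<open>Locally compact groups\<close>

locale topological_group = group G for G (structure) +
  fixes T :: "'a topology"
  assumes topspace_eq: "topspace T = carrier G"
    and continuous_mult: "continuous_map (prod_topology T T) T (\<lambda>(x, y). x \<otimes> y)"
    and continuous_inv: "continuous_map T T (\<lambda>x. inv x)"

text \<open>As usual for locally compact groups, the Hausdorff property is included.\<close>

locale locally_compact_group = topological_group +
  assumes locally_compact: "locally_compact_space T"
    and Hausdorff: "Hausdorff_space T"

definition compact_generating_set :: "('a, 'b) monoid_scheme \<Rightarrow> 'a topology \<Rightarrow> 'a set \<Rightarrow> bool"
  where "compact_generating_set G T S \<longleftrightarrow> compactin T S \<and> generate G S = carrier G"

definition compactly_generated :: "('a, 'b) monoid_scheme \<Rightarrow> 'a topology \<Rightarrow> bool"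
  where "compactly_generated G T \<longleftrightarrow> (\<exists>S. compact_generating_set G T S)"

definition densely_related :: "('a, 'b) monoid_scheme \<Rightarrow> 'a topology \<Rightarrow> bool" where
  "densely_related G T \<longleftrightarrow>
     locally_compact_group G T \<and>
     (\<exists>S. compact_generating_set G T S \<and>
       (\<exists>c::real. c > 0 \<and>
         (\<forall>n::int. n \<ge> 1 \<longrightarrow>
           (\<exists>m \<in> relation_range G S. real_of_int m \<in> {real_of_int n .. c * real_of_int n}))))"

definition quotient_group_topology :: "('a, 'b) monoid_scheme \<Rightarrow> 'a topology \<Rightarrow> 'a set \<Rightarrow> 'a set topology"
  where "quotient_group_topology G T K =
    topology (\<lambda>U. U \<subseteq> carrier (G Mod K) \<and> openin T {x \<in> topspace T. K #>\<^bsub>G\<^esub> x \<in> U})"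

lemma openin_quotient_group_topology:
  "openin (quotient_group_topology G T K) U \<longleftrightarrow>
     U \<subseteq> carrier (G Mod K) \<and> openin T {x \<in> topspace T. K #>\<^bsub>G\<^esub> x \<in> U}"
proof -
  have "istopology (\<lambda>U. U \<subseteq> carrier (G Mod K) \<and> openin T {x \<in> topspace T. K #>\<^bsub>G\<^esub> x \<in> U})"
    unfolding istopology_def
  proof (intro conjI allI impI, goal_cases)
    case (2 U V)
    have "{x \<in> topspace T. K #>\<^bsub>G\<^esub> x \<in> U \<inter> V} =
          {x \<in> topspace T. K #>\<^bsub>G\<^esub> x \<in> U} \<inter> {x \<in> topspace T. K #>\<^bsub>G\<^esub> x \<in> V}"
      by auto
    with 2 show ?case by (simp only: openin_Int)
  next
    case (4 \<U>)
    have "{x \<in> topspace T. K #>\<^bsub>G\<^esub> x \<in> \<Union>\<U>} = (\<Union>U\<in>\<U>. {x \<in> topspace T. K #>\<^bsub>G\<^esub> x \<in> U})"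
      by auto
    with 4 show ?case by auto
  qed blast+
  then show ?thesis
    unfolding quotient_group_topology_def by (simp add: topology_inverse')
qed

lemma (in topological_group) quotient_map_quotient_group_topology:
  "quotient_map T (quotient_group_topology G T K) (\<lambda>x. K #> x)"
proof -
  have img: "(\<lambda>x. K #> x) ` topspace T = carrier (G Mod K)"
    by (auto simp: FactGroup_def RCOSETS_def topspace_eq)
  have "{x \<in> topspace T. K #> x \<in> carrier (G Mod K)} = topspace T"
    using img by blast
  then have "openin (quotient_group_topology G T K) (carrier (G Mod K))"
    by (simp add: openin_quotient_group_topology)
  then have "topspace (quotient_group_topology G T K) = carrier (G Mod K)"
    unfolding topspace_def by (auto simp: openin_quotient_group_topology)
  then show ?thesis
    unfolding quotient_map_def by (simp add: img openin_quotient_group_topology)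
qed

definition stable_kernel :: "('a, 'b) monoid_scheme \<Rightarrow> ('a \<Rightarrow> 'a) \<Rightarrow> 'a set"
  where "stable_kernel G \<phi> = (\<Union>n\<in>{1..}. kernel G G (\<phi> ^^ n))"

end

(* Let B n be the set of elements of G that are products of at most n generators or inverses of
   generators. By Baire, S is contained in phi(B k) for some k, and K meets each B n inside some
   ker (phi^i). Suppose the relation range of G/K misses [N, kN], and take i minimal with
   ker (phi^i) containing the intersection of K with B (N - 1). Every relator of G/K of length at
   most kN is then a consequence of relators of length less than N, so ker (phi^i) even contains the
   intersection of K with B (kN). As B (N - 1) is contained in phi(B (kN)), ker (phi^(i - 1)) contains
   the intersection of K with B (N - 1). This contradicts minimality, since i > 0 once B (N - 1)
   contains a nontrivial element of ker phi. *)

theory Submission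
  imports Defs
begin

section \<open>Words and word balls\<close>

lemma fst_set_map_apfst_subset:
  assumes "f ` S \<subseteq> A" "fst ` set w \<subseteq> S"
  shows "fst ` set (map (apfst f) w) \<subseteq> A"
  using assms by fastforce

lemma length_cons_red: "length (cons_red p w) \<le> Suc (length w)"
  by (cases w) auto

lemma length_foldr_cons_red: "length (foldr cons_red u []) \<le> length u"
proof (induction u)
  case (Cons p u)
  then show ?case using length_cons_red[of p "foldr cons_red u []"] by simp
qed simp

lemma fst_set_foldr_cons_red: "fst ` set (foldr cons_red u []) \<subseteq> fst ` set u"
  using set_foldr[of u "[]"] by auto

lemma inv_letter_apfst: "inv_letter (apfst f p) = apfst f (inv_letter p)"
  by (cases p) (simp add: inv_letter_def)

text \<open>Words need not be reduced here, so concatenating, inverting or renaming words stays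
  inside such balls without any cancellation.\<close>

definition word_ball :: "('a, 'b) monoid_scheme \<Rightarrow> 'a set \<Rightarrow> nat \<Rightarrow> 'a set"
  where "word_ball G S n = word_val G ` {w. fst ` set w \<subseteq> S \<and> length w \<le> n}"

lemma word_ballI: "fst ` set w \<subseteq> S \<Longrightarrow> length w \<le> n \<Longrightarrow> word_val G w \<in> word_ball G S n"
  unfolding word_ball_def by blast

lemma word_ballE:
  assumes "x \<in> word_ball G S n"
  obtains w where "fst ` set w \<subseteq> S" "length w \<le> n" "x = word_val G w"
  using assms unfolding word_ball_def by blast

lemma word_ball_mono: "m \<le> n \<Longrightarrow> word_ball G S m \<subseteq> word_ball G S n"
  unfolding word_ball_def by fastforce

section \<open>Evaluating words after a change of letters\<close>

context group
begin

text \<open>Renaming letters commutes with \<open>inv_letter\<close>, so a pair cancelled in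
  \<open>w\<close> still multiplies to the identity after renaming. The renamed word itself may fail
  to be reduced, since \<open>f\<close> may identify generators.\<close>

lemma word_val_map_cons_red:
  assumes "f ` S \<subseteq> carrier G" "fst p \<in> S" "fst ` set w \<subseteq> S"
  shows "word_val G (map (apfst f) (cons_red p w)) =
         letter_val G (apfst f p) \<otimes> word_val G (map (apfst f) w)"
proof (cases w)
  case (Cons q u)
  show ?thesis
  proof (cases "q = inv_letter p")
    case True
    have p: "fst (apfst f p) \<in> carrier G"
      using assms by auto
    have u: "fst ` set (map (apfst f) u) \<subseteq> carrier G"
      using assms Cons by (intro fst_set_map_apfst_subset[OF assms(1)]) auto
    have "letter_val G (apfst f p) \<otimes> (letter_val G (apfst f q) \<otimes> word_val G (map (apfst f) u))
        = word_val G (map (apfst f) u)"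
      using p word_val_closed[OF u] True letter_val_inv_letter[OF p]
      by (simp add: m_assoc[symmetric] letter_val_closed inv_letter_apfst[symmetric] del: fst_apfst)
    then show ?thesis using Cons True by simp
  qed (use Cons in auto)
qed simp

lemma word_val_map_foldr:
  assumes "f ` S \<subseteq> carrier G" "fst ` set u \<subseteq> S" "fst ` set v \<subseteq> S"
  shows "word_val G (map (apfst f) (foldr cons_red u v)) =
         word_val G (map (apfst f) u) \<otimes> word_val G (map (apfst f) v)"
  using assms(2)
proof (induction u)
  case Nil
  have "fst ` set (map (apfst f) v) \<subseteq> carrier G"
    by (rule fst_set_map_apfst_subset[OF assms(1,3)])
  then show ?case by (simp add: word_val_closed)
next
  case (Cons p u)
  have "fst ` set (foldr cons_red u v) \<subseteq> S"
    using set_foldr[of u v] Cons.prems assms(3) by fastforce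
  moreover have "letter_val G (apfst f p) \<in> carrier G"
    using Cons.prems assms(1) by (auto intro!: letter_val_closed)
  moreover have "word_val G (map (apfst f) x) \<in> carrier G" if "fst ` set x \<subseteq> S" for x
    by (rule word_val_closed[OF fst_set_map_apfst_subset[OF assms(1) that]])
  ultimately show ?case
    using Cons assms by (simp add: word_val_map_cons_red[OF assms(1)] m_assoc)
qed

text \<open>The universal property of the free group on \<open>S\<close>. Here \<open>f\<close> is a
  mere function on the generators, so that a choice of coset representatives can be fed in.\<close>

lemma word_val_map_hom:
  assumes "f ` S \<subseteq> carrier G"
  shows "(\<lambda>w. word_val G (map (apfst f) w)) \<in> hom (free_group S) G"
proof (rule homI)
  fix x assume "x \<in> carrier (free_group S)"
  then have "fst ` set (map (apfst f) x) \<subseteq> carrier G"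
    by (intro fst_set_map_apfst_subset[OF assms]) (simp add: free_group_def)
  then show "word_val G (map (apfst f) x) \<in> carrier G"
    by (rule word_val_closed)
qed (simp add: free_group_def word_val_map_foldr[OF assms])

text \<open>Since \<open>foldr cons_red w []\<close> is the reduced form of \<open>w\<close>, this
  lets an arbitrary word be replaced by an element of the free group. The case \<open>f = id\<close>
  says that reduction preserves the value.\<close>

lemma word_val_map_reduce:
  assumes "f ` S \<subseteq> carrier G" "fst ` set w \<subseteq> S"
  shows "word_val G (map (apfst f) (foldr cons_red w [])) = word_val G (map (apfst f) w)"
proof -
  have "fst ` set (map (apfst f) w) \<subseteq> carrier G"
    by (rule fst_set_map_apfst_subset[OF assms])
  then show ?thesis
    using word_val_map_foldr[OF assms, of "[]"] by (simp add: word_val_closed)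
qed

lemma word_val_append:
  assumes "fst ` set u \<subseteq> carrier G" "fst ` set v \<subseteq> carrier G"
  shows "word_val G (u @ v) = word_val G u \<otimes> word_val G v"
  using assms(1)
  by (induction u) (simp_all add: assms(2) m_assoc letter_val_closed word_val_closed)

lemma inv_letter_val:
  "fst p \<in> carrier G \<Longrightarrow> inv (letter_val G p) = letter_val G (inv_letter p)"
  by (simp add: letter_val_def inv_letter_def)

lemma inv_word_val:
  assumes "fst ` set w \<subseteq> carrier G"
  shows "inv (word_val G w) = word_val G (rev (map inv_letter w))"
  using assms
proof (induction w)
  case (Cons p w)
  have "fst ` set (rev (map inv_letter w)) \<subseteq> carrier G"
    using Cons.prems by (simp add: image_image)
  then show ?case
    using Cons by (simp add: word_val_append inv_mult_group inv_letter_val letter_val_closed word_val_closed)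
qed simp

section \<open>Word balls as an exhaustion of the generated subgroup\<close>

context
  fixes S assumes S: "S \<subseteq> carrier G"
begin

lemma one_in_word_ball: "\<one> \<in> word_ball G S n"
  using word_ballI[of "[]" S n G] by simp

lemma generator_in_word_ball: "s \<in> S \<Longrightarrow> s \<in> word_ball G S 1"
  using word_ballI[of "[(s, True)]" S 1 G] S by (auto simp: letter_val_def)

lemma word_ball_mult:
  assumes "x \<in> word_ball G S m" "y \<in> word_ball G S n"
  shows "x \<otimes> y \<in> word_ball G S (m + n)"
proof -
  obtain u v where uv: "fst ` set u \<subseteq> S" "length u \<le> m" "x = word_val G u"
      "fst ` set v \<subseteq> S" "length v \<le> n" "y = word_val G v"
    using assms by (auto elim!: word_ballE)
  then have "x \<otimes> y = word_val G (u @ v)"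
    using S by (subst word_val_append) auto
  also have "\<dots> \<in> word_ball G S (m + n)"
    using uv by (intro word_ballI) auto
  finally show ?thesis .
qed

lemma word_ball_inv:
  assumes "x \<in> word_ball G S n"
  shows "inv x \<in> word_ball G S n"
proof -
  obtain w where w: "fst ` set w \<subseteq> S" "length w \<le> n" "x = word_val G w"
    using assms by (rule word_ballE)
  then have "inv x = word_val G (rev (map inv_letter w))"
    using S by (subst w, subst inv_word_val) auto
  also have "\<dots> \<in> word_ball G S n"
    using w by (intro word_ballI) (auto simp: image_image)
  finally show ?thesis .
qed

lemma generate_eq_Union_word_ball: "generate G S = (\<Union>n. word_ball G S n)"
proof
  show "generate G S \<subseteq> (\<Union>n. word_ball G S n)"
  proof
    fix x assume "x \<in> generate G S"
    then show "x \<in> (\<Union>n. word_ball G S n)"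
    proof (induction rule: generate.induct)
      case one
      then show ?case using one_in_word_ball by blast
    next
      case (incl h)
      then show ?case using generator_in_word_ball by blast
    next
      case (inv h)
      then show ?case using generator_in_word_ball word_ball_inv by blast
    next
      case (eng h1 h2)
      then show ?case using word_ball_mult by blast
    qed
  qed
next
  have "word_val G w \<in> generate G S" if "fst ` set w \<subseteq> S" for w
    using that
  proof (induction w)
    case (Cons p w)
    have "letter_val G p \<in> generate G S"
      using Cons.prems by (auto simp: letter_val_def intro: generate.incl generate.inv)
    then show ?case using Cons by (auto intro: generate.eng)
  qed (simp add: generate.one)
  then show "(\<Union>n. word_ball G S n) \<subseteq> generate G S"
    by (auto elim!: word_ballE)
qed

lemma word_ball_0: "word_ball G S 0 = {\<one>}"
  by (auto simp: word_ball_def)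

text \<open>Splitting off the first letter exhibits the ball as an image of a product under
  multiplication, the form needed for compactness. The inserted identity is the value of the empty
  word.\<close>

lemma word_ball_Suc:
  "word_ball G S (Suc n) =
     insert \<one> ((\<lambda>(x, y). x \<otimes> y) ` ((S \<union> m_inv G ` S) \<times> word_ball G S n))"
proof (intro equalityI subsetI)
  fix x assume "x \<in> word_ball G S (Suc n)"
  then obtain w where w: "fst ` set w \<subseteq> S" "length w \<le> Suc n" "x = word_val G w"
    by (rule word_ballE)
  show "x \<in> insert \<one> ((\<lambda>(x, y). x \<otimes> y) ` ((S \<union> m_inv G ` S) \<times> word_ball G S n))"
  proof (cases w)
    case (Cons p u)
    have "letter_val G p \<in> S \<union> m_inv G ` S"
      using w Cons by (auto simp: letter_val_def)
    moreover have "word_val G u \<in> word_ball G S n"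
      using w Cons by (intro word_ballI) auto
    ultimately show ?thesis
      using w Cons by force
  qed (use w in simp)
next
  fix x assume "x \<in> insert \<one> ((\<lambda>(x, y). x \<otimes> y) ` ((S \<union> m_inv G ` S) \<times> word_ball G S n))"
  moreover have "a \<in> word_ball G S 1" if "a \<in> S \<union> m_inv G ` S" for a
    using that generator_in_word_ball word_ball_inv by blast
  ultimately show "x \<in> word_ball G S (Suc n)"
    using word_ball_mult[of _ 1 _ n] one_in_word_ball by auto
qed

text \<open>Change of generators: each letter from \<open>R\<close> is replaced by a word of length
  at most \<open>k\<close> over \<open>S\<close>.\<close>

lemma word_ball_subset_word_ball_mult:
  assumes "R \<subseteq> word_ball G S k"
  shows "word_ball G R n \<subseteq> word_ball G S (k * n)"
proof -
  have "word_val G w \<in> word_ball G S (k * length w)" if "fst ` set w \<subseteq> R" for w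
    using that
  proof (induction w)
    case (Cons p w)
    have "letter_val G p \<in> word_ball G S k"
      using Cons.prems assms word_ball_inv by (auto simp: letter_val_def)
    then show ?case
      using Cons word_ball_mult[of "letter_val G p" k "word_val G w" "k * length w"] by simp
  qed (simp add: one_in_word_ball)
  moreover have "word_ball G S (k * m) \<subseteq> word_ball G S (k * n)" if "m \<le> n" for m
    using that by (intro word_ball_mono) simp
  ultimately show ?thesis
    unfolding word_ball_def[of G R] by fast
qed

end

end

section \<open>Word balls under homomorphisms\<close>

context group_hom
begin

lemma hom_word_val:
  assumes "fst ` set w \<subseteq> carrier G"
  shows "h (word_val G w) = word_val H (map (apfst h) w)"
  using assms
proof (induction w)
  case (Cons p w)
  have "h (letter_val G p) = letter_val H (apfst h p)"
    using Cons.prems by (simp add: letter_val_def)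
  then show ?case
    using Cons by (simp add: G.letter_val_closed G.word_val_closed)
qed simp

lemma image_word_ball:
  assumes "S \<subseteq> carrier G"
  shows "h ` word_ball G S n = word_ball H (h ` S) n"
proof (intro equalityI subsetI)
  fix y assume "y \<in> h ` word_ball G S n"
  then obtain w where w: "fst ` set w \<subseteq> S" "length w \<le> n" "y = h (word_val G w)"
    by (auto elim!: word_ballE)
  then have "y = word_val H (map (apfst h) w)"
    using hom_word_val[OF order_trans[OF w(1) assms]] by simp
  also have "\<dots> \<in> word_ball H (h ` S) n"
    using w by (intro word_ballI fst_set_map_apfst_subset[of h S]) auto
  finally show "y \<in> word_ball H (h ` S) n" .
next
  fix y assume "y \<in> word_ball H (h ` S) n"
  then obtain v where v: "fst ` set v \<subseteq> h ` S" "length v \<le> n" "y = word_val H v"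
    by (rule word_ballE)
  \<comment> \<open>Lifting letter by letter through a section of \<open>h\<close> over the image of
    \<open>S\<close> keeps the length.\<close>
  define w where "w = map (apfst (inv_into S h)) v"
  have w: "fst ` set w \<subseteq> S"
    unfolding w_def using v(1) by (intro fst_set_map_apfst_subset[of _ "h ` S"]) (auto intro: inv_into_into)
  have "map (apfst h) w = v"
    using v(1) unfolding w_def by (force simp: f_inv_into_f intro!: map_idI)
  then have "y = h (word_val G w)"
    using hom_word_val[OF order_trans[OF w assms]] v(3) by simp
  moreover have "word_val G w \<in> word_ball G S n"
    using v w by (intro word_ballI) (auto simp: w_def)
  ultimately show "y \<in> h ` word_ball G S n" by blast
qed

end


section \<open>Gaps in the relation range\<close>

lemma subset_normal_closure: "A \<subseteq> normal_closure G A"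
  unfolding normal_closure_def by blast

lemma normal_closure_minimal: "N \<lhd> G \<Longrightarrow> A \<subseteq> N \<Longrightarrow> normal_closure G A \<subseteq> N"
  unfolding normal_closure_def by blast

lemma normal_closure_mono: "A \<subseteq> B \<Longrightarrow> normal_closure G A \<subseteq> normal_closure G B"
  unfolding normal_closure_def by blast

lemma relators_le_mono: "m \<le> n \<Longrightarrow> relators_le G S m \<subseteq> relators_le G S n"
  unfolding relators_le_def by (intro normal_closure_mono) auto

text \<open>The relation range marks exactly the nonnegative indices at which the chain of normal
  subgroups grows, so the chain stays constant along a gap. The condition \<open>0 \<le> n\<close>
  ensures that absence from the range really excludes growth.\<close>

lemma relators_le_eq_if_gap:
  assumes "0 \<le> n" "n - 1 \<le> M" "\<And>m. n \<le> m \<Longrightarrow> m \<le> M \<Longrightarrow> m \<notin> relation_range G S"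
  shows "relators_le G S M = relators_le G S (n - 1)"
  using assms(2,3)
proof (induction M rule: int_ge_induct)
  case (step i)
  then have "i + 1 \<notin> relation_range G S" by simp
  then have "relators_le G S (i + 1) = relators_le G S i"
    using relators_le_mono[of i "i + 1" G S] step.hyps assms(1)
    by (auto simp: relation_range_def)
  then show ?case using step by simp
qed simp

text \<open>A generator of the quotient is a coset, with possibly several representatives in \<open>S\<close>; since
  \<open>n \<ge> 2\<close>, their images under \<open>h\<close> agree, so \<open>h\<close> lives on the free group on the cosets.\<close>

lemma (in group_hom) kernel_word_ball_if_relators_le_eq:
  assumes K: "K \<lhd> G" and S: "S \<subseteq> carrier G"
    and eq: "relators_le (G Mod K) ((\<lambda>x. K #>\<^bsub>G\<^esub> x) ` S) (int M) =
             relators_le (G Mod K) ((\<lambda>x. K #>\<^bsub>G\<^esub> x) ` S) (int n)"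
    and n: "2 \<le> n" and ker: "K \<inter> word_ball G S n \<subseteq> kernel G H h"
  shows "K \<inter> word_ball G S M \<subseteq> kernel G H h"
proof -
  interpret K: normal K G by (rule K)
  interpret Q: group "G Mod K" by (rule K.factorgroup_is_group)
  interpret q: group_hom G "G Mod K" "\<lambda>x. K #>\<^bsub>G\<^esub> x"
    by unfold_locales (rule K.r_coset_hom_Mod)
  define q where "q = (\<lambda>x. K #>\<^bsub>G\<^esub> x)"
  define SQ where "SQ = q ` S"
  \<comment> \<open>A section of the projection over the generating cosets, with representatives
    chosen in \<open>S\<close>.\<close>
  define \<sigma> where "\<sigma> = inv_into S q"
  have \<sigma>: "\<sigma> X \<in> S" "q (\<sigma> X) = X" if "X \<in> SQ" for X
    using that unfolding SQ_def \<sigma>_def by (rule inv_into_into, rule f_inv_into_f)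
  have SQ: "SQ \<subseteq> carrier (G Mod K)"
    using S q.hom_closed unfolding SQ_def q_def by blast
  have qK: "q x = \<one>\<^bsub>G Mod K\<^esub> \<longleftrightarrow> x \<in> K" if "x \<in> carrier G" for x
    using that K.subgroup_axioms G.coset_join1 G.coset_join2 unfolding q_def by (metis one_FactGroup)
  have h\<sigma>: "(h \<circ> \<sigma>) ` SQ \<subseteq> carrier H"
    using \<sigma>(1) S hom_closed by fastforce
  have h\<sigma>q: "h (\<sigma> (q s)) = h s" if s: "s \<in> S" for s
  proof -
    have "q s \<in> SQ"
      unfolding SQ_def using s by (rule imageI)
    note t = \<sigma>[OF this]
    have c: "s \<in> carrier G" "\<sigma> (q s) \<in> carrier G"
      using s t S by auto
    \<comment> \<open>The two representatives lie in one coset, so this quotient lies in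
      \<open>K\<close>; as a product of two letters it also lies in the ball of radius 2, where
      \<open>ker\<close> applies.\<close>
    let ?x = "\<sigma> (q s) \<otimes>\<^bsub>G\<^esub> inv\<^bsub>G\<^esub> s"
    have "q ?x = q (\<sigma> (q s)) \<otimes>\<^bsub>G Mod K\<^esub> inv\<^bsub>G Mod K\<^esub> q s"
      unfolding q_def using c[unfolded q_def] by (simp only: q.hom_mult q.hom_inv G.inv_closed)
    also have "\<dots> = \<one>\<^bsub>G Mod K\<^esub>"
      using t(2) c(1) q.hom_closed[of s] Q.r_inv[of "q s"] by (simp add: q_def)
    finally have "?x \<in> K"
      using qK c by simp
    moreover have "?x \<in> word_ball G S (1 + 1)"
      using s t S by (intro G.word_ball_mult G.word_ball_inv G.generator_in_word_ball)
    then have "?x \<in> word_ball G S n"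
      using word_ball_mono[of "1+1" n G S] n by auto
    ultimately have "h ?x = \<one>\<^bsub>H\<^esub>"
      using ker by (auto simp: kernel_def)
    then have "h (\<sigma> (q s)) \<otimes>\<^bsub>H\<^esub> inv\<^bsub>H\<^esub> h s = \<one>\<^bsub>H\<^esub>"
      using c by simp
    then show ?thesis
      using c by (metis H.inv_equality H.inv_inv H.inv_closed hom_closed)
  qed
  \<comment> \<open>The homomorphism from the free group on the cosets that sends a coset
    \<open>X\<close> to \<open>h (\<sigma> X)\<close>.\<close>
  define g where "g = (\<lambda>w. word_val H (map (apfst (h \<circ> \<sigma>)) w))"
  interpret g: group_hom "free_group SQ" H g
    unfolding g_def using H.word_val_map_hom[OF h\<sigma>] group_free_group
    by (auto simp: group_hom_def group_hom_axioms_def)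
  \<comment> \<open>A relator of length at most \<open>n\<close> lifts through
    \<open>\<sigma>\<close> to a word of the same length whose value lies in \<open>K\<close>; by
    \<open>ker\<close> this value is killed by \<open>h\<close>.\<close>
  have "{w \<in> relators (G Mod K) SQ. int (length w) \<le> int n} \<subseteq> kernel (free_group SQ) H g"
  proof
    fix w assume "w \<in> {w \<in> relators (G Mod K) SQ. int (length w) \<le> int n}"
    then have w: "w \<in> carrier (free_group SQ)" "word_val (G Mod K) w = \<one>\<^bsub>G Mod K\<^esub>" "length w \<le> n"
      by (auto simp: relators_def kernel_def)
    then have wSQ: "fst ` set w \<subseteq> SQ"
      by (simp add: free_group_def)
    define u where "u = map (apfst \<sigma>) w"
    have uS: "fst ` set u \<subseteq> S"
      unfolding u_def using wSQ \<sigma>(1) by (intro fst_set_map_apfst_subset[of _ SQ]) auto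
    then have uG: "fst ` set u \<subseteq> carrier G"
      using S by auto
    have "map (apfst q) u = w"
      using wSQ \<sigma>(2) unfolding u_def by (auto intro!: map_idI)
    then have "q (word_val G u) = \<one>\<^bsub>G Mod K\<^esub>"
      using q.hom_word_val[OF uG] w(2) unfolding q_def by simp
    then have "word_val G u \<in> K"
      using qK G.word_val_closed[OF uG] by simp
    moreover have "word_val G u \<in> word_ball G S n"
      using uS w(3) by (intro word_ballI) (auto simp: u_def)
    ultimately have "h (word_val G u) = \<one>\<^bsub>H\<^esub>"
      using ker by (auto simp: kernel_def)
    then have "g w = \<one>\<^bsub>H\<^esub>"
      using hom_word_val[OF uG] unfolding g_def u_def by (simp add: comp_def apfst_compose)
    then show "w \<in> kernel (free_group SQ) H g"
      using w(1) by (simp add: kernel_def)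
  qed
  \<comment> \<open>The kernel of \<open>g\<close> is normal, so it contains the normal closure of
    the short relators; \<open>eq\<close> turns this into a statement about length
    \<open>M\<close>.\<close>
  then have sub: "relators_le (G Mod K) SQ (int M) \<subseteq> kernel (free_group SQ) H g"
    using eq g.normal_kernel
    unfolding relators_le_def SQ_def[unfolded q_def, symmetric] by (simp add: normal_closure_minimal)
  show ?thesis
  proof
    fix x assume "x \<in> K \<inter> word_ball G S M"
    then obtain w where w: "fst ` set w \<subseteq> S" "length w \<le> M" "x = word_val G w" and xK: "x \<in> K"
      by (auto elim!: word_ballE)
    have wG: "fst ` set w \<subseteq> carrier G"
      using w S by auto
    define v where "v = map (apfst q) w"
    have vSQ: "fst ` set v \<subseteq> SQ"
      unfolding v_def using w(1) by (intro fst_set_map_apfst_subset[of _ S]) (auto simp: SQ_def)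
    have "q x = word_val (G Mod K) v"
      using q.hom_word_val[OF wG] w(3) unfolding v_def q_def by simp
    then have v1: "word_val (G Mod K) v = \<one>\<^bsub>G Mod K\<^esub>"
      using qK[of x] xK by simp
    \<comment> \<open>The word of cosets may be unreduced and has to be reduced to become an element
      of the free group. This does not increase the length and changes neither its value nor the
      value of \<open>g\<close>.\<close>
    define v' where "v' = foldr cons_red v []"
    have "word_val (G Mod K) v' = \<one>\<^bsub>G Mod K\<^esub>"
      using Q.word_val_map_reduce[of id SQ v] SQ vSQ v1 by (simp add: v'_def)
    moreover have "v' \<in> carrier (free_group SQ)"
      using vSQ fst_set_foldr_cons_red[of v] by (auto simp: free_group_def v'_def reduced_foldr)
    moreover have "length v' \<le> M"
      using length_foldr_cons_red[of v] w(2) by (simp add: v'_def v_def)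
    ultimately have "v' \<in> relators_le (G Mod K) SQ (int M)"
      unfolding relators_le_def relators_def kernel_def
      by (intro subsetD[OF subset_normal_closure]) simp
    then have "\<one>\<^bsub>H\<^esub> = g v'"
      using sub by (auto simp: kernel_def)
    also have "\<dots> = word_val H (map (apfst (h \<circ> \<sigma>)) v)"
      unfolding g_def v'_def by (rule H.word_val_map_reduce[OF h\<sigma> vSQ])
    \<comment> \<open>By \<open>h\<sigma>q\<close>, passing to the coset and back to its chosen
      representative does not affect the image of a generator under \<open>h\<close>.\<close>
    also have "map (apfst (h \<circ> \<sigma>)) v = map (apfst h) w"
      using w(1) h\<sigma>q unfolding v_def by auto
    also have "word_val H \<dots> = h x"
      using hom_word_val[OF wG] w(3) by simp
    finally show "x \<in> kernel G H h"
      using xK by (simp add: kernel_def)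
  qed
qed

section \<open>Quotients and closed subgroups of locally compact groups\<close>

text \<open>A product of quotient maps need not be a quotient map, but openness passes to products.
  This makes the square of the coset projection a quotient map.\<close>

lemma open_map_map_prod:
  assumes f: "open_map X X' f" and g: "open_map Y Y' g"
  shows "open_map (prod_topology X Y) (prod_topology X' Y') (\<lambda>(x, y). (f x, g y))"
  unfolding open_map_def
proof (intro allI impI)
  fix U assume U: "openin (prod_topology X Y) U"
  show "openin (prod_topology X' Y') ((\<lambda>(x, y). (f x, g y)) ` U)"
    unfolding openin_prod_topology_alt
  proof (intro allI impI)
    fix a b assume "(a, b) \<in> (\<lambda>(x, y). (f x, g y)) ` U"
    then obtain x y where xy: "(x, y) \<in> U" "a = f x" "b = g y"
      by auto
    then obtain V W where VW: "openin X V" "openin Y W" "x \<in> V" "y \<in> W" "V \<times> W \<subseteq> U"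
      using U unfolding openin_prod_topology_alt by meson
    have "openin X' (f ` V)" "openin Y' (g ` W)"
      using f g VW by (auto simp: open_map_def)
    moreover have "f ` V \<times> g ` W \<subseteq> (\<lambda>(x, y). (f x, g y)) ` U"
      using VW(5) by force
    ultimately show "\<exists>V W. openin X' V \<and> openin Y' W \<and> a \<in> V \<and> b \<in> W \<and>
        V \<times> W \<subseteq> (\<lambda>(x, y). (f x, g y)) ` U"
      using xy VW by blast
  qed
qed

context topological_group
begin

lemma continuous_map_mult:
  "continuous_map X T f \<Longrightarrow> continuous_map X T g \<Longrightarrow> continuous_map X T (\<lambda>x. f x \<otimes> g x)"
  using continuous_map_compose[OF continuous_map_pairedI continuous_mult, of X f g]
  by (simp add: comp_def)

lemma continuous_map_inverse: "continuous_map X T f \<Longrightarrow> continuous_map X T (\<lambda>x. inv (f x))"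
  using continuous_map_compose[OF _ continuous_inv] by (simp add: comp_def)

lemma continuous_map_mult_const: "a \<in> carrier G \<Longrightarrow> continuous_map T T (\<lambda>x. a \<otimes> x)"
  by (intro continuous_map_mult) (auto simp: topspace_eq)

lemma subgroup_topological_group:
  assumes H: "subgroup H G"
  shows "topological_group (G\<lparr>carrier := H\<rparr>) (subtopology T H)"
proof -
  have sub: "H \<subseteq> carrier G"
    using H by (rule subgroup.subset)
  have 1: "continuous_map (prod_topology (subtopology T H) (subtopology T H)) (subtopology T H)
      (\<lambda>(x, y). x \<otimes> y)"
    unfolding continuous_map_in_subtopology
    using continuous_map_from_subtopology[OF continuous_mult, of "H \<times> H"] H
    by (auto simp: subtopology_Times subgroup.m_closed)
  have "continuous_map (subtopology T H) (subtopology T H) (\<lambda>x. inv x)"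
    unfolding continuous_map_in_subtopology
    using continuous_map_from_subtopology[OF continuous_inv, of H] H
    by (auto simp: subgroup.m_inv_closed)
  then have 2: "continuous_map (subtopology T H) (subtopology T H) (\<lambda>x. inv\<^bsub>G\<lparr>carrier := H\<rparr>\<^esub> x)"
    by (rule continuous_map_eq) (use H in auto)
  show ?thesis
    using 1 2 sub subgroup_imp_group[OF H]
    by (auto simp: topological_group_def topological_group_axioms_def topspace_eq)
qed

text \<open>The saturation of an open set \<open>U\<close> is the union of its translates by
  inverses of elements of \<open>K\<close>, and each translate is open.\<close>

lemma open_map_r_coset:
  assumes K: "subgroup K G"
  shows "open_map T (quotient_group_topology G T K) (\<lambda>x. K #> x)"
  unfolding open_map_def
proof (intro allI impI)
  fix U assume U: "openin T U"
  then have UG: "U \<subseteq> carrier G"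
    using openin_subset topspace_eq by blast
  have KG: "K \<subseteq> carrier G"
    using K by (rule subgroup.subset)
  have "{x \<in> topspace T. K #> x \<in> (\<lambda>x. K #> x) ` U} = (\<Union>k\<in>K. {x \<in> topspace T. k \<otimes> x \<in> U})"
  proof (intro equalityI subsetI)
    fix x assume "x \<in> {x \<in> topspace T. K #> x \<in> (\<lambda>x. K #> x) ` U}"
    then obtain u where u: "u \<in> U" "K #> x = K #> u" and x: "x \<in> carrier G"
      by (auto simp: topspace_eq)
    then have "u \<in> K #> x"
      using K UG by (metis rcos_self subsetD)
    then obtain k where "k \<in> K" "u = k \<otimes> x"
      by (auto simp: r_coset_def)
    then show "x \<in> (\<Union>k\<in>K. {x \<in> topspace T. k \<otimes> x \<in> U})"
      using u x by (auto simp: topspace_eq)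
  next
    fix x assume "x \<in> (\<Union>k\<in>K. {x \<in> topspace T. k \<otimes> x \<in> U})"
    then obtain k where k: "k \<in> K" "k \<otimes> x \<in> U" and x: "x \<in> carrier G"
      by (auto simp: topspace_eq)
    have "k \<otimes> x \<in> K #> x"
      using k by (auto simp: r_coset_def)
    then have "K #> x = K #> (k \<otimes> x)"
      using x K by (rule repr_independence)
    then show "x \<in> {x \<in> topspace T. K #> x \<in> (\<lambda>x. K #> x) ` U}"
      using k x by (auto simp: topspace_eq)
  qed
  moreover have "openin T {x \<in> topspace T. k \<otimes> x \<in> U}" if "k \<in> K" for k
    using openin_continuous_map_preimage[OF continuous_map_mult_const U] that KG by blast
  ultimately have "openin T {x \<in> topspace T. K #> x \<in> (\<lambda>x. K #> x) ` U}"
    by auto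
  moreover have "(\<lambda>x. K #> x) ` U \<subseteq> carrier (G Mod K)"
    using UG by (auto simp: FactGroup_def RCOSETS_def)
  ultimately show "openin (quotient_group_topology G T K) ((\<lambda>x. K #> x) ` U)"
    by (simp add: openin_quotient_group_topology)
qed

lemma topspace_quotient_group_topology:
  "topspace (quotient_group_topology G T K) = carrier (G Mod K)"
  using quotient_imp_surjective_map[OF quotient_map_quotient_group_topology, of K]
  by (auto simp: topspace_eq FactGroup_def RCOSETS_def)

text \<open>The operations on cosets pull back to continuous maps along the projection
  \<open>q\<close> and its square \<open>p\<close>; continuity descends because both are quotient
  maps.\<close>

lemma quotient_topological_group:
  assumes K: "K \<lhd> G"
  shows "topological_group (G Mod K) (quotient_group_topology G T K)"
proof -
  interpret K: normal K G by (rule K)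
  define Q where "Q = quotient_group_topology G T K"
  define q where "q = (\<lambda>x. K #> x)"
  have q: "quotient_map T Q q"
    unfolding Q_def q_def by (rule quotient_map_quotient_group_topology)
  have qo: "open_map T Q q"
    unfolding Q_def q_def by (rule open_map_r_coset) (rule K.subgroup_axioms)
  have qc: "continuous_map T Q q"
    using q by (rule quotient_imp_continuous_map)
  have top: "topspace Q = carrier (G Mod K)"
    unfolding Q_def by (rule topspace_quotient_group_topology)
  have surj: "q ` carrier G = carrier (G Mod K)"
    unfolding q_def by (auto simp: FactGroup_def RCOSETS_def)
  have hom: "q x \<otimes>\<^bsub>G Mod K\<^esub> q y = q (x \<otimes> y)" if "x \<in> carrier G" "y \<in> carrier G" for x y
    using that by (simp add: q_def K.rcos_sum)
  have grp: "group (G Mod K)"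
    by (rule K.factorgroup_is_group)
  have qinv: "inv\<^bsub>G Mod K\<^esub> q x = q (inv x)" if "x \<in> carrier G" for x
    using that surj K.inv_FactGroup[of "q x"] K.rcos_inv[OF that] by (simp add: q_def image_subset_iff set_eq_subset)
  define p where "p = (\<lambda>(x, y). (q x, q y))"
  have po: "open_map (prod_topology T T) (prod_topology Q Q) p"
    unfolding p_def using open_map_map_prod[OF qo qo] .
  have pc: "continuous_map (prod_topology T T) (prod_topology Q Q) p"
    unfolding p_def using qc by (simp add: continuous_map_prod_top)
  have ps: "p ` topspace (prod_topology T T) = topspace (prod_topology Q Q)"
    unfolding p_def by (simp add: topspace_eq top surj image_paired_Times)
  have pq: "quotient_map (prod_topology T T) (prod_topology Q Q) p"
    using po pc ps by (simp add: continuous_open_imp_quotient_map)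
  have "continuous_map (prod_topology T T) Q (q \<circ> (\<lambda>(x, y). x \<otimes> y))"
    by (rule continuous_map_compose[OF continuous_mult qc])
  then have "continuous_map (prod_topology T T) Q ((\<lambda>(X, Y). X \<otimes>\<^bsub>G Mod K\<^esub> Y) \<circ> p)"
    by (rule continuous_map_eq) (auto simp: p_def hom topspace_eq simp del: mult_FactGroup)
  then have 1: "continuous_map (prod_topology Q Q) Q (\<lambda>(X, Y). X \<otimes>\<^bsub>G Mod K\<^esub> Y)"
    using pq by (simp only: continuous_compose_quotient_map_eq)
  have "continuous_map T Q (q \<circ> (\<lambda>x. inv x))"
    by (rule continuous_map_compose[OF continuous_inv qc])
  then have "continuous_map T Q ((\<lambda>X. inv\<^bsub>G Mod K\<^esub> X) \<circ> q)"
    by (rule continuous_map_eq) (auto simp: qinv topspace_eq)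
  then have 2: "continuous_map Q Q (\<lambda>X. inv\<^bsub>G Mod K\<^esub> X)"
    using q by (simp only: continuous_compose_quotient_map_eq)
  show ?thesis
    using grp top 1 2 unfolding Q_def topological_group_def topological_group_axioms_def by blast
qed

text \<open>The diagonal is the preimage of the identity under the continuous map taking
  \<open>(x, y)\<close> to \<open>x \<otimes> inv y\<close>.\<close>

lemma Hausdorff_if_closed_one:
  assumes "closedin T {\<one>}"
  shows "Hausdorff_space T"
proof -
  have "continuous_map (prod_topology T T) T (\<lambda>z. fst z \<otimes> inv (snd z))"
    by (intro continuous_map_mult continuous_map_inverse continuous_map_fst continuous_map_snd)
  then have "closedin (prod_topology T T)
      {z \<in> topspace (prod_topology T T). fst z \<otimes> inv (snd z) \<in> {\<one>}}"
    using assms by (rule closedin_continuous_map_preimage)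
  also have "{z \<in> topspace (prod_topology T T). fst z \<otimes> inv (snd z) \<in> {\<one>}} =
      (\<lambda>x. (x, x)) ` topspace T"
    using inv_solve_right'[of \<one>] by (auto simp: topspace_eq)
  finally show ?thesis
    by (simp add: Hausdorff_space_closedin_diagonal)
qed

lemma closedin_one_quotient:
  assumes K: "K \<lhd> G" and cl: "closedin T K"
  shows "closedin (quotient_group_topology G T K) {\<one>\<^bsub>G Mod K\<^esub>}"
proof -
  interpret K: normal K G by (rule K)
  have "{x \<in> topspace T. K #> x \<in> {K}} = K"
    using coset_join1[of K] coset_join2[of _ K] K.subset K.subgroup_axioms by (auto simp: topspace_eq)
  then have "closedin T {x \<in> topspace T. K #> x \<in> {K}}"
    using cl by simp
  moreover have "K \<in> carrier (G Mod K)"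
    using K.subgroup_axioms by (metis K.factorgroup_is_group group.is_monoid monoid.one_closed one_FactGroup)
  ultimately show ?thesis
    using quotient_map_quotient_group_topology[of K]
    by (auto simp: quotient_map_closedin topspace_quotient_group_topology)
qed

end

section \<open>Local compactness and exhaustion by closed sets\<close>

context locally_compact_group
begin

lemma subgroup_locally_compact_group:
  assumes "subgroup H G" "closedin T H"
  shows "locally_compact_group (G\<lparr>carrier := H\<rparr>) (subtopology T H)"
  using subgroup_topological_group[OF assms(1)] locally_compact_space_closed_subset[OF locally_compact assms(2)]
    Hausdorff_space_subtopology[OF Hausdorff]
  by (simp add: locally_compact_group_def locally_compact_group_axioms_def)

lemma quotient_locally_compact_group:
  assumes K: "K \<lhd> G" and cl: "closedin T K"
  shows "locally_compact_group (G Mod K) (quotient_group_topology G T K)"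
proof -
  interpret Q: topological_group "G Mod K" "quotient_group_topology G T K"
    using K by (rule quotient_topological_group)
  have q: "quotient_map T (quotient_group_topology G T K) (\<lambda>x. K #> x)"
    by (rule quotient_map_quotient_group_topology)
  have "locally_compact_space (quotient_group_topology G T K)"
    using quotient_imp_continuous_map[OF q] open_map_r_coset quotient_imp_surjective_map[OF q] locally_compact
    by (rule locally_compact_space_continuous_open_map_image) (use K in \<open>simp add: normal_def\<close>)
  then show ?thesis
    using Q.Hausdorff_if_closed_one[OF closedin_one_quotient[OF K cl]]
    by unfold_locales
qed

lemma closedin_kernel:
  assumes "continuous_map T T f"
  shows "closedin T (kernel G G f)"
proof -
  have "closedin T {\<one>}"
    using Hausdorff by (simp add: closedin_Hausdorff_singleton topspace_eq)
  then have "closedin T {x \<in> topspace T. f x \<in> {\<one>}}"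
    using assms by (rule closedin_continuous_map_preimage[rotated])
  then show ?thesis by (simp add: kernel_def topspace_eq)
qed

text \<open>By Baire, some \<open>A m\<close> has nonempty interior, which can be translated to any given point.\<close>

lemma compactin_subset_exhaustion:
  fixes A :: "nat \<Rightarrow> 'a set"
  assumes closed: "\<And>n. closedin T (A n)" and union: "(\<Union>n. A n) = carrier G"
    and mono: "\<And>m n. m \<le> n \<Longrightarrow> A m \<subseteq> A n"
    and mult: "\<And>m n x y. x \<in> A m \<Longrightarrow> y \<in> A n \<Longrightarrow> x \<otimes> y \<in> A (m + n)"
    and inv: "\<And>n x. x \<in> A n \<Longrightarrow> inv x \<in> A n"
    and C: "compactin T C"
  shows "\<exists>n. C \<subseteq> A n"
proof -
  have "\<exists>m. T interior_of A m \<noteq> {}"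
  proof (rule ccontr)
    assume "\<nexists>m. T interior_of A m \<noteq> {}"
    then have "T interior_of \<Union>(range A) = {}"
      using locally_compact locally_compact_Hausdorff_imp_regular_space[OF locally_compact Hausdorff] closed
      by (intro Baire_category_alt) auto
    then show False
      using union by (metis empty_iff interior_of_topspace one_closed topspace_eq)
  qed
  then obtain m w where w: "w \<in> T interior_of A m"
    by blast
  define W where "W = T interior_of A m"
  have W: "openin T W" "W \<subseteq> A m" "w \<in> W"
    using w by (auto simp: W_def interior_of_subset)
  have wG: "w \<in> carrier G"
    using W openin_subset topspace_eq by blast
  \<comment> \<open>The translate of \<open>W\<close> that moves \<open>w\<close> to
    \<open>g\<close>, hence an open neighbourhood of \<open>g\<close>.\<close>
  define V where "V g = {x \<in> topspace T. (w \<otimes> inv g) \<otimes> x \<in> W}" for g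
  have V_open: "openin T (V g)" if "g \<in> carrier G" for g
    unfolding V_def using W that wG
    by (intro openin_continuous_map_preimage[OF continuous_map_mult_const]) auto
  have V_self: "g \<in> V g" if "g \<in> carrier G" for g
    using that W wG by (simp add: V_def topspace_eq m_assoc)
  have V_sub: "\<exists>n. V g \<subseteq> A n" if g: "g \<in> carrier G" for g
  proof -
    obtain l where l: "g \<in> A l"
      using g union by blast
    \<comment> \<open>Write \<open>x\<close> as the product of \<open>g\<close>,
      \<open>inv w\<close> and \<open>w \<otimes> inv g \<otimes> x\<close>; the three factors lie
      in \<open>A l\<close>, \<open>A m\<close> and \<open>A m\<close>.\<close>
    have "x \<in> A (l + m + m)" if "x \<in> V g" for x
    proof -
      have x: "x \<in> carrier G" "(w \<otimes> inv g) \<otimes> x \<in> A m"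
        using that W by (auto simp: V_def topspace_eq)
      have "(g \<otimes> inv w) \<otimes> ((w \<otimes> inv g) \<otimes> x) \<in> A (l + m + m)"
        using l x W by (intro mult inv) auto
      moreover have "(g \<otimes> inv w) \<otimes> ((w \<otimes> inv g) \<otimes> x) = x"
        using g x(1) wG by (simp add: m_assoc[symmetric]) (simp add: m_assoc)
      ultimately show ?thesis by simp
    qed
    then show ?thesis by blast
  qed
  have CG: "C \<subseteq> carrier G"
    using compactin_subset_topspace[OF C] by (simp add: topspace_eq)
  have "C \<subseteq> \<Union>(V ` C)" "\<And>U. U \<in> V ` C \<Longrightarrow> openin T U"
    using V_open V_self CG by auto
  then have "\<exists>\<F>. finite \<F> \<and> \<F> \<subseteq> V ` C \<and> C \<subseteq> \<Union>\<F>"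
    using compactinD[OF C, of "V ` C"] by blast
  then obtain F where F: "finite F" "F \<subseteq> C" "C \<subseteq> (\<Union>g\<in>F. V g)"
    by (metis finite_subset_image)
  have "\<forall>g\<in>F. \<exists>n. V g \<subseteq> A n"
    using V_sub F CG by blast
  then obtain N where N: "\<And>g. g \<in> F \<Longrightarrow> V g \<subseteq> A (N g)"
    by metis
  \<comment> \<open>If \<open>F\<close> is empty the maximum is unspecified, but then
    \<open>C\<close> is empty too and any index serves.\<close>
  have "A (N g) \<subseteq> A (Max (N ` F))" if "g \<in> F" for g
    using that F by (intro mono) simp
  then show ?thesis
    using N F by blast
qed

text \<open>A closed subgroup is itself a locally compact group, so the exhaustion argument can run
  inside it. This is needed for sets that fill only the stable kernel.\<close>

lemma compactin_subset_exhaustion_subgroup: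
  fixes A :: "nat \<Rightarrow> 'a set"
  assumes H: "subgroup H G" "closedin T H"
    and closed: "\<And>n. closedin T (A n)" and union: "(\<Union>n. A n) = H"
    and mono: "\<And>m n. m \<le> n \<Longrightarrow> A m \<subseteq> A n"
    and mult: "\<And>m n x y. x \<in> A m \<Longrightarrow> y \<in> A n \<Longrightarrow> x \<otimes> y \<in> A (m + n)"
    and inv: "\<And>n x. x \<in> A n \<Longrightarrow> inv x \<in> A n"
    and C: "compactin T C" "C \<subseteq> H"
  shows "\<exists>n. C \<subseteq> A n"
proof -
  interpret H: locally_compact_group "G\<lparr>carrier := H\<rparr>" "subtopology T H"
    using H by (rule subgroup_locally_compact_group)
  show ?thesis
  proof (rule H.compactin_subset_exhaustion)
    fix n
    have "A n \<subseteq> H" using union by blast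
    then show "closedin (subtopology T H) (A n)"
      using closed by (simp add: closedin_closed_subtopology H(2))
  next
    fix n x assume "x \<in> A n"
    moreover from this have "x \<in> H" using union by blast
    ultimately show "inv\<^bsub>G\<lparr>carrier := H\<rparr>\<^esub> x \<in> A n"
      using inv H by simp
  next
    fix m n :: nat assume "m \<le> n"
    then show "A m \<subseteq> A n" by (rule mono)
  qed (use union mult C in \<open>auto simp: compactin_subtopology\<close>)
qed

end

section \<open>Stable kernels\<close>

lemma (in topological_group) compactin_word_ball:
  assumes S: "compactin T S"
  shows "compactin T (word_ball G S n)"
proof -
  have SG: "S \<subseteq> carrier G"
    using compactin_subset_topspace[OF S] by (simp add: topspace_eq)
  have one: "compactin T {\<one>}"
    by (simp add: topspace_eq)
  show ?thesis
  proof (induction n)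
    case 0
    show ?case using one by (simp add: word_ball_0[OF SG])
  next
    case (Suc n)
    have "compactin T (S \<union> m_inv G ` S)"
      using S by (intro compactin_Un image_compactin[OF _ continuous_inv])
    then have "compactin (prod_topology T T) ((S \<union> m_inv G ` S) \<times> word_ball G S n)"
      using Suc by (simp add: compactin_Times)
    then have "compactin T ((\<lambda>(x, y). x \<otimes> y) ` ((S \<union> m_inv G ` S) \<times> word_ball G S n))"
      by (rule image_compactin[OF _ continuous_mult])
    then show ?case
      unfolding word_ball_Suc[OF SG] using compactin_Un[OF one] by simp
  qed
qed

lemma funpow_hom:
  assumes "f \<in> hom G G"
  shows "f ^^ n \<in> hom G G"
proof (induction n)
  case (Suc n)
  then show ?case using hom_compose[OF Suc assms] by (simp only: funpow.simps)
qed (simp add: hom_def)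

lemma continuous_map_funpow:
  assumes "continuous_map X X f"
  shows "continuous_map X X (f ^^ n)"
proof (induction n)
  case (Suc n)
  then show ?case using continuous_map_compose[OF Suc assms] by (simp only: funpow.simps)
qed (simp add: id_def)

section \<open>The increasing chain of kernels of iterates\<close>

locale group_endomorphism = group_hom G G \<phi> for G (structure) and \<phi>
begin

lemma group_hom_funpow: "group_hom G G (\<phi> ^^ n)"
  using funpow_hom[OF homh] by unfold_locales

lemma kernel_funpow_mono:
  assumes "m \<le> n"
  shows "kernel G G (\<phi> ^^ m) \<subseteq> kernel G G (\<phi> ^^ n)"
  using _ assms by (rule lift_Suc_mono_le) (auto simp: kernel_def)

text \<open>Exponent 0 adds only the kernel of the identity map, which later kernels contain.
  Starting at 0 gives a chain whose first term is trivial, as the minimality argument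
  requires.\<close>

lemma stable_kernel_eq: "stable_kernel G \<phi> = (\<Union>n. kernel G G (\<phi> ^^ n))"
proof
  show "(\<Union>n. kernel G G (\<phi> ^^ n)) \<subseteq> stable_kernel G \<phi>"
  proof (rule UN_least)
    fix n
    have "kernel G G (\<phi> ^^ n) \<subseteq> kernel G G (\<phi> ^^ Suc n)"
      by (rule kernel_funpow_mono) simp
    then show "kernel G G (\<phi> ^^ n) \<subseteq> stable_kernel G \<phi>"
      unfolding stable_kernel_def by (rule order_trans) (rule UN_upper, simp)
  qed
qed (auto simp: stable_kernel_def)

text \<open>An increasing union of normal subgroups: two elements already lie in one common kernel,
  with exponent \<open>max m n\<close>.\<close>

lemma stable_kernel_normal: "stable_kernel G \<phi> \<lhd> G"
  unfolding G.normal_inv_iff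
proof (intro conjI ballI)
  note normal = group_hom.normal_kernel[OF group_hom_funpow]
  note subgroup = group_hom.subgroup_kernel[OF group_hom_funpow]
  show "subgroup (stable_kernel G \<phi>) G"
  proof (rule G.subgroupI)
    show "stable_kernel G \<phi> \<subseteq> carrier G"
      by (auto simp: stable_kernel_eq kernel_def)
    show "stable_kernel G \<phi> \<noteq> {}"
      using subgroup.one_closed[OF subgroup] by (auto simp: stable_kernel_eq)
    show "inv a \<in> stable_kernel G \<phi>" if "a \<in> stable_kernel G \<phi>" for a
      using that subgroup.m_inv_closed[OF subgroup] by (auto simp: stable_kernel_eq)
    fix a b assume "a \<in> stable_kernel G \<phi>" "b \<in> stable_kernel G \<phi>"
    then obtain m n where mn: "a \<in> kernel G G (\<phi> ^^ m)" "b \<in> kernel G G (\<phi> ^^ n)"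
      by (auto simp: stable_kernel_eq)
    have "a \<in> kernel G G (\<phi> ^^ max m n)" "b \<in> kernel G G (\<phi> ^^ max m n)"
      using mn kernel_funpow_mono[of m "max m n"] kernel_funpow_mono[of n "max m n"] by auto
    then show "a \<otimes> b \<in> stable_kernel G \<phi>"
      using subgroup.m_closed[OF subgroup] by (auto simp: stable_kernel_eq)
  qed
  fix x a assume "x \<in> carrier G" "a \<in> stable_kernel G \<phi>"
  then show "x \<otimes> a \<otimes> inv x \<in> stable_kernel G \<phi>"
    using normal unfolding stable_kernel_eq G.normal_inv_iff by blast
qed

text \<open>One further application of \<open>\<phi>\<close> only raises the exponent by one. This
  keeps preimages of elements of the stable kernel inside it.\<close>

lemma stable_kernel_vimage:
  assumes "x \<in> carrier G" "\<phi> x \<in> stable_kernel G \<phi>"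
  shows "x \<in> stable_kernel G \<phi>"
proof -
  obtain n where "(\<phi> ^^ n) (\<phi> x) = \<one>"
    using assms(2) by (auto simp: stable_kernel_eq kernel_def)
  then have "x \<in> kernel G G (\<phi> ^^ Suc n)"
    using assms(1) by (simp add: kernel_def funpow_swap1)
  then show ?thesis
    unfolding stable_kernel_eq by blast
qed

end

theorem proposition1p3:
  fixes G :: "('a, 'b) monoid_scheme" and T :: "'a topology" and \<phi> :: "'a \<Rightarrow> 'a"
  assumes "locally_compact_group G T"
    and "compactly_generated G T"
    and "\<phi> \<in> hom G G"
    and "continuous_map T T \<phi>"
    and "\<phi> ` carrier G = carrier G"
    and "\<not> inj_on \<phi> (carrier G)"
    and "closedin T (stable_kernel G \<phi>)"
  shows "densely_related (G Mod stable_kernel G \<phi>)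
           (quotient_group_topology G T (stable_kernel G \<phi>))"
proof -
  interpret locally_compact_group G T by (rule assms(1))
  interpret \<phi>: group_endomorphism G \<phi>
    using assms(3) by unfold_locales
  define K where "K = stable_kernel G \<phi>"
  define L where "L n = kernel G G (\<phi> ^^ n)" for n
  have K_eq: "K = (\<Union>n. L n)"
    unfolding K_def L_def by (rule \<phi>.stable_kernel_eq)
  interpret K: normal K G
    unfolding K_def by (rule \<phi>.stable_kernel_normal)
  obtain S where S: "compactin T S" "generate G S = carrier G"
    using assms(2) by (auto simp: compactly_generated_def compact_generating_set_def)
  have SG: "S \<subseteq> carrier G"
    using compactin_subset_topspace[OF S(1)] by (simp add: topspace_eq)
  define B where "B n = word_ball G S n" for n
  have B_compact: "compactin T (B n)" for n
    unfolding B_def using S(1) by (rule compactin_word_ball)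
  have B_union: "(\<Union>n. B n) = carrier G"
    using generate_eq_Union_word_ball[OF SG] S(2) by (simp add: B_def)
  have B_sub: "B n \<subseteq> carrier G" for n
    using B_union by blast
  have B_mono: "B m \<subseteq> B n" if "m \<le> n" for m n
    unfolding B_def using that by (rule word_ball_mono)

  \<comment> \<open>Expressing generators by images of short words\<close>
  have "\<exists>k. S \<subseteq> \<phi> ` B k"
  \<comment> \<open>The images of the balls are compact, hence closed by the Hausdorff property, and
    they exhaust the group because \<open>\<phi>\<close> is surjective.\<close>
  proof (rule compactin_subset_exhaustion)
    show "closedin T (\<phi> ` B n)" for n
      by (intro compactin_imp_closedin[OF Hausdorff] image_compactin[OF B_compact assms(4)])
    show "(\<Union>n. \<phi> ` B n) = carrier G"
      using B_union assms(5) by (metis image_UN)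
    show "\<phi> ` B m \<subseteq> \<phi> ` B n" if "m \<le> n" for m n
      using B_mono[OF that] by blast
    show "x \<otimes>\<^bsub>G\<^esub> y \<in> \<phi> ` B (m + n)" if xy: "x \<in> \<phi> ` B m" "y \<in> \<phi> ` B n" for m n x y
    proof -
      obtain a b where ab: "a \<in> B m" "x = \<phi> a" "b \<in> B n" "y = \<phi> b"
        using xy by blast
      then have "x \<otimes>\<^bsub>G\<^esub> y = \<phi> (a \<otimes>\<^bsub>G\<^esub> b)"
        using B_sub by (metis \<phi>.hom_mult subsetD)
      then show ?thesis
        using ab word_ball_mult[OF SG] by (auto simp: B_def)
    qed
    show "inv\<^bsub>G\<^esub> x \<in> \<phi> ` B n" if x: "x \<in> \<phi> ` B n" for n x
    proof -
      obtain a where a: "a \<in> B n" "x = \<phi> a"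
        using x by blast
      then have "inv\<^bsub>G\<^esub> x = \<phi> (inv\<^bsub>G\<^esub> a)"
        using B_sub by (metis \<phi>.hom_inv subsetD)
      then show ?thesis
        using a word_ball_inv[OF SG] by (auto simp: B_def)
    qed
  qed (rule S(1))
  then obtain k0 where "S \<subseteq> \<phi> ` B k0" by blast
  \<comment> \<open>The successor makes \<open>k\<close> positive, so that
    \<open>N \<le> k * N\<close> holds below.\<close>
  define k where "k = Suc k0"
  have "S \<subseteq> \<phi> ` B k"
    using \<open>S \<subseteq> \<phi> ` B k0\<close> B_mono[of k0 k] by (auto simp: k_def)
  then have "S \<subseteq> word_ball G (\<phi> ` S) k"
    using \<phi>.image_word_ball[OF SG, of k] by (simp add: B_def)
  moreover have "\<phi> ` S \<subseteq> carrier G"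
    using SG by auto
  \<comment> \<open>Every generator is a word of length at most \<open>k\<close> over the images of
    \<open>S\<close>; substituting these words stretches lengths by the factor
    \<open>k\<close>.\<close>
  ultimately have B_image: "B n \<subseteq> \<phi> ` B (k * n)" for n
    using word_ball_subset_word_ball_mult[of "\<phi> ` S" S k n] \<phi>.image_word_ball[OF SG, of "k * n"]
    by (simp add: B_def)

  \<comment> \<open>A uniform exponent on each word ball\<close>
  have ex_L: "\<exists>i. K \<inter> B n \<subseteq> L i" for n
  \<comment> \<open>The kernels \<open>L i\<close> are closed subgroups increasing to
    \<open>K\<close>, and \<open>K \<inter> B n\<close> is compact as a closed part of a compact
    set.\<close>
  proof (rule compactin_subset_exhaustion_subgroup)
    show "subgroup K G" by (rule K.subgroup_axioms)
    show "closedin T K" using assms(7) by (simp add: K_def)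
    show "closedin T (L i)" for i
      unfolding L_def by (intro closedin_kernel continuous_map_funpow assms(4))
    show "(\<Union>i. L i) = K" by (simp add: K_eq)
    show mono: "L i \<subseteq> L j" if "i \<le> j" for i j
      unfolding L_def using that by (rule \<phi>.kernel_funpow_mono)
    have L_sub: "subgroup (L i) G" for i
      unfolding L_def by (rule group_hom.subgroup_kernel[OF \<phi>.group_hom_funpow])
    show "x \<otimes>\<^bsub>G\<^esub> y \<in> L (i + j)" if "x \<in> L i" "y \<in> L j" for i j x y
      using that mono[of i "i + j"] mono[of j "i + j"] by (intro subgroup.m_closed[OF L_sub]) auto
    show "inv\<^bsub>G\<^esub> x \<in> L i" if "x \<in> L i" for i x
      using that by (rule subgroup.m_inv_closed[OF L_sub])
    show "compactin T (K \<inter> B n)"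
      using assms(7) B_compact unfolding K_def by (rule closed_Int_compactin)
  qed simp

  \<comment> \<open>Ruling out long gaps\<close>
  obtain x where x: "x \<in> carrier G" "\<phi> x = \<one>\<^bsub>G\<^esub>" "x \<noteq> \<one>\<^bsub>G\<^esub>"
    using assms(6) \<phi>.inj_iff_trivial_ker by (auto simp: kernel_def)
  then have "x \<in> L 1"
    by (simp add: L_def kernel_def)
  then have xK: "x \<in> K"
    using K_eq by blast
  obtain n0 where xB: "x \<in> B n0"
    using x(1) B_union by blast
  \<comment> \<open>For \<open>N \<ge> n1\<close> the radius \<open>N - 1\<close> is at least 2, as
    comparing representatives requires, and at least \<open>n0\<close>, so that the ball contains
    \<open>x\<close>.\<close>
  define n1 where "n1 = max 2 n0 + 1"

  define SQ where "SQ = (\<lambda>x. K #>\<^bsub>G\<^esub> x) ` S"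
  have gap: "\<exists>m\<in>relation_range (G Mod K) SQ. int N \<le> m \<and> m \<le> int (k * N)" if N: "n1 \<le> N" for N
  proof (rule ccontr)
    assume no: "\<not> ?thesis"
    have N': "int N - 1 = int (N - 1)" "2 \<le> N - 1" "n0 \<le> N - 1"
      using N by (auto simp: n1_def)
    have "int N \<le> int (k * N)"
      by (simp add: k_def)
    then have eq: "relators_le (G Mod K) SQ (int (k * N)) = relators_le (G Mod K) SQ (int (N - 1))"
      unfolding N'(1)[symmetric] using no by (intro relators_le_eq_if_gap) auto
    define i where "i = (LEAST i. K \<inter> B (N - 1) \<subseteq> L i)"
    have i: "K \<inter> B (N - 1) \<subseteq> L i"
      unfolding i_def using ex_L by (rule LeastI_ex)
    have "x \<in> B (N - 1)"
      using xB B_mono[OF N'(3)] by blast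
    then have "x \<in> L i"
      using xK i by blast
    \<comment> \<open>\<open>L 0\<close> is the kernel of the identity map and cannot contain
      \<open>x \<noteq> \<one>\<close>.\<close>
    then have "i \<noteq> 0"
      using x by (auto simp: L_def kernel_def intro: ccontr)
    then obtain j where j: "i = Suc j"
      using not0_implies_Suc by blast
    interpret \<phi>i: group_hom G G "\<phi> ^^ i"
      by (rule \<phi>.group_hom_funpow)
    \<comment> \<open>The gap lemma is applied to the iterate \<open>\<phi> ^^ i\<close> as the
      homomorphism, from radius \<open>N - 1\<close> to radius \<open>k * N\<close>.\<close>
    have long: "K \<inter> B (k * N) \<subseteq> L i"
      using \<phi>i.kernel_word_ball_if_relators_le_eq[OF K.normal_axioms SG eq[unfolded SQ_def] N'(2)] i
      unfolding L_def B_def by blast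
    \<comment> \<open>Pulling \<open>y\<close> back along \<open>\<phi>\<close> to \<open>z\<close>
      costs the factor \<open>k\<close> in length, which \<open>long\<close> absorbs; killing
      \<open>z\<close> by \<open>\<phi> ^^ Suc j\<close> is the same as killing \<open>y\<close> by
      \<open>\<phi> ^^ j\<close>.\<close>
    have "K \<inter> B (N - 1) \<subseteq> L j"
    proof
      fix y assume y: "y \<in> K \<inter> B (N - 1)"
      then obtain z where z: "z \<in> B (k * (N - 1))" "y = \<phi> z"
        using B_image by blast
      have zG: "z \<in> carrier G"
        using z(1) B_sub by blast
      have "z \<in> B (k * N)"
        using z(1) B_mono[of "k * (N - 1)" "k * N"] by auto
      moreover have "z \<in> K"
        using \<phi>.stable_kernel_vimage[OF zG] y z(2) by (simp add: K_def)
      ultimately have "(\<phi> ^^ Suc j) z = \<one>\<^bsub>G\<^esub>"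
        using long j by (auto simp: L_def kernel_def)
      then show "y \<in> L j"
        using zG z(2) by (simp add: L_def kernel_def funpow_swap1)
    qed
    then have "i \<le> j"
      unfolding i_def by (rule Least_le)
    then show False
      using j by simp
  qed

  \<comment> \<open>Compact generation of the quotient and the final constant\<close>
  have "compact_generating_set (G Mod K) (quotient_group_topology G T K) SQ"
  proof -
    interpret Q: group "G Mod K" by (rule K.factorgroup_is_group)
    interpret q: group_hom G "G Mod K" "\<lambda>x. K #>\<^bsub>G\<^esub> x"
      by unfold_locales (rule K.r_coset_hom_Mod)
    have "compactin (quotient_group_topology G T K) SQ"
      unfolding SQ_def using S(1) quotient_imp_continuous_map[OF quotient_map_quotient_group_topology]
      by (rule image_compactin)
    moreover have "generate (G Mod K) SQ = carrier (G Mod K)"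
      using q.generate_img[OF SG] S(2) by (auto simp: SQ_def FactGroup_def RCOSETS_def)
    ultimately show ?thesis
      by (simp add: compact_generating_set_def)
  qed
  \<comment> \<open>\<open>gap\<close> only covers \<open>N \<ge> n1\<close>. Applying it at
    \<open>n1 * n\<close> reaches every \<open>n \<ge> 1\<close>, at the price of enlarging the
    constant from \<open>k\<close> to \<open>k * n1\<close>.\<close>
  moreover have "\<exists>m\<in>relation_range (G Mod K) SQ. real_of_int m \<in> {real_of_int n..real (k * n1) * real_of_int n}"
    if n: "n \<ge> 1" for n :: int
  proof -
    define N where "N = n1 * nat n"
    have "1 \<le> nat n"
      using n by simp
    then have "n1 \<le> N"
      unfolding N_def by simp
    then obtain m where m: "m \<in> relation_range (G Mod K) SQ" "int N \<le> m" "m \<le> int (k * N)"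
      using gap by blast
    have "1 * n \<le> int n1 * n"
      using n by (intro mult_right_mono) (simp_all add: n1_def)
    also have "\<dots> = int N"
      using n by (simp add: N_def)
    finally have "n \<le> m"
      using m(2) by linarith
    moreover have "m \<le> int (k * n1) * n"
      using m(3) n by (simp add: N_def)
    then have "real_of_int m \<le> real_of_int (int (k * n1) * n)"
      by (simp only: of_int_le_iff)
    then have "real_of_int m \<le> real (k * n1) * real_of_int n"
      by simp
    ultimately show ?thesis
      using m(1) by (intro bexI[of _ m]) auto
  qed
  moreover have "real (k * n1) > 0"
    unfolding of_nat_0_less_iff by (simp add: k_def n1_def)
  moreover have "locally_compact_group (G Mod K) (quotient_group_topology G T K)"
    using K.normal_axioms assms(7) unfolding K_def by (rule quotient_locally_compact_group)
  ultimately show ?thesis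
    unfolding densely_related_def K_def[symmetric] by blast
qed

end
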